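(* Let $w\in S_n$ avoid the patterns $1432$ and $1423$, and let \[ c_w := \sum_{v\le w} (-1)^{|w|-|v|}\,\mathfrak{S}_{\mathrm{perm}(v)}(\mathbf{1}), \] the sum over all subwords $v$ of $w$ (including the empty word, with $\mathfrak{S}_{\mathrm{perm}(())}(\mathbf 1):=1$). Then $c_w$ equals the number of diagrams $C\le D(w)$ for which there do not exist $k\in[n]$ and a diagram $\widehat{C}$ with no boxes in row $k$ or column $l:=w(k)$ satisfying $\widehat{C}\le \widehat{D}$ and $C=\widehat{C}_{\mathrm{aug}}$, where $\widehat{D}$ is obtained from $D(w)$ by removing all boxes in row $k$ or column $l$, and $\widehat{C}_{\mathrm{aug}} := \widehat{C}\cup\{(k,i) : (k,i)\in D(w)\}\cup\{(i,l) : (i,l)\in D(w)\}$.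
   Context: Permutations are written in one-line notation and regarded as words; $u\le v$ for words means $u$ is a subword of $v$; $|v|$ is the length. $w$ avoids $\pi\in S_k$ if no length-$k$ subword of $w$ has the relative order of $\pi$. $\mathrm{perm}(v)$ is the permutation with the same relative order as the word $v$; $\mathfrak{S}_\pi(\mathbf 1)$ is the Schubert polynomial evaluated at all variables equal to $1$. A diagram is a subset of $[n]\times[n]$ (box $(i,j)$ in row $i$, column $j$), equivalently a sequence of columns $(D_1,\dots,D_n)$ with $D_j=\{i:(i,j)\in D\}$. For $R,S\subseteq[n]$, $R\le S$ means $\#R=\#S$ and the $t$-th smallest element of $R$ is at most the $t$-th smallest element of $S$ for every $t$; for diagrams, $C\le D$ means $C_j\le D_j$ for all $j$. The Rothe diagram of $w\in S_n$ is $D(w)=\{(i,j): i<w^{-1}(j),\ j<w(i)\}$. *)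

theory Defs
  imports
    "HOL-Library.Poly_Mapping"
    "HOL-Library.Sublist"
    "HOL-Combinatorics.Permutations"
begin

section \<open>Permutations as words\<close>

text \<open>A permutation in \<open>S\<^sub>n\<close> is a function \<open>w\<close> with \<^term>\<open>w permutes {1..n}\<close>;
  all indices are 1-based.\<close>

definition one_line :: "nat \<Rightarrow> (nat \<Rightarrow> nat) \<Rightarrow> nat list" where
  "one_line n w = map w [1..<Suc n]"

definition same_relative_order :: "nat list \<Rightarrow> nat list \<Rightarrow> bool" where
  "same_relative_order u v \<longleftrightarrow>
     length u = length v \<and> (\<forall>i<length u. \<forall>j<length u. u ! i < u ! j \<longleftrightarrow> v ! i < v ! j)"

definition avoids_pattern :: "nat list \<Rightarrow> nat list \<Rightarrow> bool" where
  "avoids_pattern w \<pi> \<longleftrightarrow> \<not> (\<exists>u. subseq u w \<and> same_relative_order u \<pi>)"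

text \<open>The letters of the words in question are distinct, so replacing each letter by its rank
  gives the permutation in \<open>S\<^sub>k\<close>, \<open>k = |v|\<close>, with the same relative order
  (lemmas \<open>perm_permutes\<close> and \<open>perm_same_relative_order\<close>).\<close>

definition perm :: "nat list \<Rightarrow> nat \<Rightarrow> nat" where
  "perm v i = (if i \<in> {1..length v} then card {y \<in> set v. y \<le> v ! (i - 1)} else i)"

lemma rank_less_iff:
  fixes a b :: nat
  assumes "finite A" "a \<in> A" "b \<in> A"
  shows "card {y \<in> A. y \<le> a} < card {y \<in> A. y \<le> b} \<longleftrightarrow> a < b"
proof
  assume less: "card {y \<in> A. y \<le> a} < card {y \<in> A. y \<le> b}"
  show "a < b"
  proof (rule ccontr)
    assume "\<not> a < b"
    then have "{y \<in> A. y \<le> b} \<subseteq> {y \<in> A. y \<le> a}" by auto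
    then have "card {y \<in> A. y \<le> b} \<le> card {y \<in> A. y \<le> a}"
      using assms by (intro card_mono) auto
    with less show False by simp
  qed
next
  assume "a < b"
  then have "{y \<in> A. y \<le> a} \<subset> {y \<in> A. y \<le> b}" using assms by force
  then show "card {y \<in> A. y \<le> a} < card {y \<in> A. y \<le> b}"
    using assms by (intro psubset_card_mono) auto
qed

lemma perm_permutes:
  assumes "distinct v"
  shows "perm v permutes {1..length v}"
proof (rule bij_imp_permutes)
  show "perm v x = x" if "x \<notin> {1..length v}" for x
    unfolding perm_def using that by (rule if_not_P)
  have "inj_on (perm v) {1..length v}"
  proof (rule inj_onI)
    fix i j assume ij: "i \<in> {1..length v}" "j \<in> {1..length v}" and eq: "perm v i = perm v j"
    have mem: "v ! (i - 1) \<in> set v" "v ! (j - 1) \<in> set v" using ij by auto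
    have "v ! (i - 1) = v ! (j - 1)"
      using eq ij rank_less_iff[OF finite_set mem] rank_less_iff[OF finite_set mem(2) mem(1)]
      by (simp add: perm_def) 
    then have "i - 1 = j - 1"
      using assms ij nth_eq_iff_index_eq[of v "i - 1" "j - 1"] by auto
    then show "i = j" using ij by auto
  qed
  moreover have "perm v ` {1..length v} \<subseteq> {1..length v}"
  proof
    fix x assume "x \<in> perm v ` {1..length v}"
    then obtain i where i: "i \<in> {1..length v}" "x = card {y \<in> set v. y \<le> v ! (i - 1)}"
      by (auto simp: perm_def)
    have "v ! (i - 1) \<in> {y \<in> set v. y \<le> v ! (i - 1)}" using i by auto
    then have "card {y \<in> set v. y \<le> v ! (i - 1)} > 0"
      by (subst card_gt_0_iff) auto
    moreover have "card {y \<in> set v. y \<le> v ! (i - 1)} \<le> card (set v)"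
      by (intro card_mono) auto
    ultimately show "x \<in> {1..length v}"
      using i card_length[of v] by simp
  qed
  ultimately show "bij_betw (perm v) {1..length v} {1..length v}"
    by (simp add: bij_betw_def endo_inj_surj)
qed

lemma perm_same_relative_order: "same_relative_order (one_line (length v) (perm v)) v"
  by (auto simp: same_relative_order_def one_line_def perm_def rank_less_iff simp del: upt_Suc)


section \<open>Schubert polynomials\<close>

text \<open>Polynomials over the integers in \<open>x\<^sub>1, x\<^sub>2, \<dots>\<close>: a monomial is its exponent vector.\<close>

type_synonym monomial = "nat \<Rightarrow>\<^sub>0 nat"
type_synonym mpoly_int = "monomial \<Rightarrow>\<^sub>0 int"

definition var :: "nat \<Rightarrow> mpoly_int" where
  "var i = Poly_Mapping.single (Poly_Mapping.single i 1) 1"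

definition eval_poly :: "mpoly_int \<Rightarrow> (nat \<Rightarrow> int) \<Rightarrow> int" where
  "eval_poly f a =
     (\<Sum>m \<in> Poly_Mapping.keys f. Poly_Mapping.lookup f m *
        (\<Prod>i \<in> Poly_Mapping.keys m. a i ^ Poly_Mapping.lookup m i))"

text \<open>Exchanging \<open>x\<^sub>i\<close> and \<open>x\<^sub>i\<^sub>+\<^sub>1\<close>: the coefficient at \<open>m\<close> becomes
  that at \<open>m \<circ> s\<^sub>i\<close>.\<close>

definition swap_vars :: "nat \<Rightarrow> mpoly_int \<Rightarrow> mpoly_int" where
  "swap_vars i f = Poly_Mapping.map_key (Poly_Mapping.map_key (transpose i (Suc i))) f"

text \<open>\<open>\<partial>\<^sub>i f = (f - s\<^sub>i f) / (x\<^sub>i - x\<^sub>i\<^sub>+\<^sub>1)\<close>.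
  The quotient exists and is unique, see \<open>divided_difference_mult\<close>.\<close>

definition divided_difference :: "nat \<Rightarrow> mpoly_int \<Rightarrow> mpoly_int" where
  "divided_difference i f = (THE g. (var i - var (Suc i)) * g = f - swap_vars i f)"

lemma inj_map_key_transpose:
  "inj (Poly_Mapping.map_key (transpose i j) :: monomial \<Rightarrow> monomial)"
proof (rule inj_on_inverseI)
  fix m :: monomial
  show "Poly_Mapping.map_key (transpose i j) (Poly_Mapping.map_key (transpose i j) m) = m"
    by (rule poly_mapping_eqI) (simp add: Poly_Mapping.map_key.rep_eq)
qed

lemma swap_vars_single:
  "swap_vars i (Poly_Mapping.single m c) =
     Poly_Mapping.single (Poly_Mapping.map_key (transpose i (Suc i)) m) c"
proof -
  let ?t = "Poly_Mapping.map_key (transpose i (Suc i)) :: monomial \<Rightarrow> monomial"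
  have "?t (?t m) = m"
    by (rule poly_mapping_eqI) (simp add: Poly_Mapping.map_key.rep_eq)
  then show ?thesis
    using map_key_single[OF inj_map_key_transpose, of i "Suc i" "?t m" c]
    by (simp add: swap_vars_def)
qed

lemma swap_vars_add: "swap_vars i (f + g) = swap_vars i f + swap_vars i g"
  by (simp add: swap_vars_def map_key_plus[OF inj_map_key_transpose])

lemma var_power: "var i ^ a = Poly_Mapping.single (Poly_Mapping.single i a) 1"
  by (induction a) (simp_all add: var_def mult_single single_add[symmetric])

lemma diff_dvd_monomial_diff:
  fixes x y :: "'a :: comm_ring_1"
  shows "x - y dvd x ^ a * y ^ b - x ^ b * y ^ a"
proof (induction a b rule: linorder_wlog)
  case (le a b)
  have "x - y dvd y ^ (b - a) - x ^ (b - a)"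
    by (subst minus_diff_eq[symmetric], subst dvd_minus_iff) (simp add: power_diff_sumr2)
  moreover have "x ^ a * y ^ b - x ^ b * y ^ a = x ^ a * y ^ a * (y ^ (b - a) - x ^ (b - a))"
  proof -
    have "x ^ b = x ^ a * x ^ (b - a)" "y ^ b = y ^ a * y ^ (b - a)"
      using le by (simp_all flip: power_add)
    then show ?thesis by (simp add: algebra_simps)
  qed
  ultimately show ?case by simp
next
  case (sym a b)
  then show ?case by (subst minus_diff_eq[symmetric], subst dvd_minus_iff) simp
qed

lemma var_diff_dvd: "var i - var (Suc i) dvd f - swap_vars i f"
proof (induction f rule: update_induct)
  case const
  show ?case by (simp add: swap_vars_def map_key_zero[OF inj_map_key_transpose])
next
  case (update f m c)
  define a where "a = Poly_Mapping.lookup m i"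
  define b where "b = Poly_Mapping.lookup m (Suc i)"
  define r where "r = Poly_Mapping.update i 0 (Poly_Mapping.update (Suc i) 0 m)"
  have m: "m = r + Poly_Mapping.single i a + Poly_Mapping.single (Suc i) b"
    by (rule poly_mapping_eqI)
       (auto simp: a_def b_def r_def lookup_add lookup_single lookup_update when_def)
  have tm: "Poly_Mapping.map_key (transpose i (Suc i)) m =
      r + Poly_Mapping.single i b + Poly_Mapping.single (Suc i) a"
    by (rule poly_mapping_eqI)
       (auto simp: a_def b_def r_def lookup_add lookup_single lookup_update when_def
         Poly_Mapping.map_key.rep_eq transpose_def)
  have split: "Poly_Mapping.single (r + Poly_Mapping.single i p + Poly_Mapping.single (Suc i) q) c
      = Poly_Mapping.single r c * (var i ^ p * var (Suc i) ^ q)" for p q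
    by (simp add: var_power mult_single add.assoc)
  have upd: "Poly_Mapping.update m c f = f + Poly_Mapping.single m c"
    using update.hyps
    by (intro poly_mapping_eqI)
       (auto simp: lookup_update lookup_add lookup_single when_def in_keys_iff)
  have sm: "Poly_Mapping.single m c = Poly_Mapping.single r c * (var i ^ a * var (Suc i) ^ b)"
    using split[of a b] m by simp
  have "var i - var (Suc i) dvd Poly_Mapping.single r c *
        (var i ^ a * var (Suc i) ^ b - var i ^ b * var (Suc i) ^ a)"
    by (intro dvd_mult diff_dvd_monomial_diff)
  also have "\<dots> = Poly_Mapping.single m c - swap_vars i (Poly_Mapping.single m c)"
    unfolding swap_vars_single tm split unfolding sm by (rule right_diff_distrib)
  finally have "var i - var (Suc i) dvd
      (f - swap_vars i f) + (Poly_Mapping.single m c - swap_vars i (Poly_Mapping.single m c))"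
    using update.IH by (intro dvd_add)
  also have "\<dots> = Poly_Mapping.update m c f - swap_vars i (Poly_Mapping.update m c f)"
    by (simp add: upd swap_vars_add)
  finally show ?case .
qed

lemma divided_difference_mult:
  "(var i - var (Suc i)) * divided_difference i f = f - swap_vars i f"
proof -
  have "Poly_Mapping.lookup (Poly_Mapping.single (Suc i) (1::nat)) i \<noteq>
      Poly_Mapping.lookup (Poly_Mapping.single i 1) i"
    by (simp add: lookup_single)
  then have ne: "Poly_Mapping.single (Suc i) (1::nat) \<noteq> Poly_Mapping.single i 1" by metis
  have "Poly_Mapping.lookup (var i - var (Suc i)) (Poly_Mapping.single i 1) = 1"
    by (simp add: var_def lookup_minus lookup_single_eq lookup_single_not_eq ne[simplified] ne[symmetric, simplified])
  then have "var i - var (Suc i) \<noteq> 0" by auto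
  then have "\<exists>!g. (var i - var (Suc i)) * g = f - swap_vars i f"
    using var_diff_dvd[of i f] by (auto elim!: dvdE)
  then show ?thesis unfolding divided_difference_def by (rule theI')
qed

text \<open>\<open>\<SS>\<^sub>w\<close> for \<open>w \<in> S\<^sub>n\<close>:
  \<open>\<SS>\<^bsub>w\<^sub>0\<^esub> = x\<^sub>1\<^sup>n\<^sup>-\<^sup>1 x\<^sub>2\<^sup>n\<^sup>-\<^sup>2 \<cdots> x\<^sub>n\<^sub>-\<^sub>1\<close>, and
  \<open>\<SS>\<^sub>w = \<partial>\<^sub>i \<SS>\<^bsub>w s\<^sub>i\<^esub>\<close> if \<open>w(i) < w(i+1)\<close>.
  The result does not depend on which ascent \<open>i\<close> is used, since the \<open>\<partial>\<^sub>i\<close> satisfy the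
  braid relations; the recursion takes the least one. A permutation in \<open>S\<^sub>n\<close> without
  ascents is the longest element \<open>w\<^sub>0\<close>.\<close>

definition is_ascent :: "nat \<Rightarrow> (nat \<Rightarrow> nat) \<Rightarrow> nat \<Rightarrow> bool" where
  "is_ascent n w i \<longleftrightarrow> 1 \<le> i \<and> i < n \<and> w i < w (Suc i)"

definition noninversions :: "nat \<Rightarrow> (nat \<Rightarrow> nat) \<Rightarrow> (nat \<times> nat) set" where
  "noninversions n w = {(a, b). 1 \<le> a \<and> a < b \<and> b \<le> n \<and> w a < w b}"

lemma card_noninversions_swap:
  assumes "is_ascent n w i"
  shows "card (noninversions n (w \<circ> transpose i (Suc i))) < card (noninversions n w)"
proof -
  let ?t = "transpose i (Suc i)"
  let ?N = "noninversions n w" and ?N' = "noninversions n (w \<circ> ?t)"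
  have i: "1 \<le> i" "i < n" "w i < w (Suc i)" using assms by (auto simp: is_ascent_def)
  have fin: "finite ?N"
    by (rule finite_subset[of _ "{1..n} \<times> {1..n}"]) (auto simp: noninversions_def)
  have sub: "map_prod ?t ?t ` ?N' \<subseteq> ?N - {(i, Suc i)}"
    using i by (auto simp: noninversions_def transpose_def split: if_splits)
  have inj: "inj_on (map_prod ?t ?t) ?N'"
    by (rule inj_on_inverseI[where g = "map_prod ?t ?t"]) auto
  have "card ?N' \<le> card (?N - {(i, Suc i)})"
    using card_image[OF inj] card_mono[OF _ sub] fin by simp
  also have "\<dots> < card ?N"
    using i fin by (intro card_Diff1_less) (auto simp: noninversions_def)
  finally show ?thesis .
qed

function schubert :: "nat \<Rightarrow> (nat \<Rightarrow> nat) \<Rightarrow> mpoly_int" where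
  "schubert n w =
     (if \<exists>i. is_ascent n w i
      then let i = (LEAST i. is_ascent n w i)
           in divided_difference i (schubert n (w \<circ> transpose i (Suc i)))
      else \<Prod>i\<in>{1..n}. var i ^ (n - i))"
  by auto
termination
proof (relation "measure (\<lambda>(n, w). card (noninversions n w))", goal_cases)
  case (2 n w i)
  from 2(1) have "is_ascent n w i" unfolding 2(2) by (rule LeastI_ex)
  then show ?case using card_noninversions_swap by (simp del: comp_apply)
qed simp

declare schubert.simps [simp del]


section \<open>Diagrams\<close>

text \<open>A box \<open>(i, j)\<close> lies in row \<open>i\<close> and column \<open>j\<close>.\<close>

type_synonym diagram = "(nat \<times> nat) set"

definition is_diagram :: "nat \<Rightarrow> diagram \<Rightarrow> bool" where
  "is_diagram n D \<longleftrightarrow> D \<subseteq> {1..n} \<times> {1..n}"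

definition column :: "diagram \<Rightarrow> nat \<Rightarrow> nat set" where
  "column D j = {i. (i, j) \<in> D}"

definition set_le :: "nat set \<Rightarrow> nat set \<Rightarrow> bool" where
  "set_le R S \<longleftrightarrow> card R = card S \<and>
     (\<forall>t<card R. sorted_list_of_set R ! t \<le> sorted_list_of_set S ! t)"

definition diagram_le :: "nat \<Rightarrow> diagram \<Rightarrow> diagram \<Rightarrow> bool" where
  "diagram_le n C D \<longleftrightarrow> (\<forall>j\<in>{1..n}. set_le (column C j) (column D j))"

definition rothe :: "nat \<Rightarrow> (nat \<Rightarrow> nat) \<Rightarrow> diagram" where
  "rothe n w = {(i, j) \<in> {1..n} \<times> {1..n}. i < inv w j \<and> j < w i}"

definition remove_row_col :: "nat \<Rightarrow> nat \<Rightarrow> diagram \<Rightarrow> diagram" where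
  "remove_row_col k l D = {(i, j) \<in> D. i \<noteq> k \<and> j \<noteq> l}"

definition augment :: "nat \<Rightarrow> nat \<Rightarrow> diagram \<Rightarrow> diagram \<Rightarrow> diagram" where
  "augment k l D C = C \<union> {(k, i) |i. (k, i) \<in> D} \<union> {(i, l) |i. (i, l) \<in> D}"

definition is_augmented :: "nat \<Rightarrow> (nat \<Rightarrow> nat) \<Rightarrow> diagram \<Rightarrow> bool" where
  "is_augmented n w C \<longleftrightarrow>
     (\<exists>k\<in>{1..n}. \<exists>C'. is_diagram n C' \<and>
        (\<forall>(i, j)\<in>C'. i \<noteq> k \<and> j \<noteq> w k) \<and>
        diagram_le n C' (remove_row_col k (w k) (rothe n w)) \<and>
        C = augment k (w k) (rothe n w) C')"


section \<open>The coefficient \<open>c\<^sub>w\<close>\<close>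

text \<open>The letters of \<open>w\<close> are distinct, so distinct subsequences of positions give distinct words
  and the sum runs over the set of subwords.\<close>

definition c_coeff :: "nat \<Rightarrow> (nat \<Rightarrow> nat) \<Rightarrow> int" where
  "c_coeff n w = (\<Sum>v | subseq v (one_line n w).
     (- 1) ^ (n - length v) * eval_poly (schubert (length v) (perm v)) (\<lambda>_. 1))"

end

theory Submission
  imports Defs
begin

text \<open>
  For \<open>w\<close> avoiding 1432 and 1423 the Schubert polynomial is the product over the columns
  \<open>D\<^sub>j\<close> of \<open>D(w)\<close> of the column polynomials
  \<open>\<Sum>x\<^sup>R\<close>, \<open>R \<le> D\<^sub>j\<close>, so that \<open>\<SS>\<^sub>w(1)\<close>
  counts the diagrams \<open>C \<le> D(w)\<close>. This goes by induction along the least ascents \<open>i\<close>: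
  as \<open>w(i)\<close> is the minimum of the first \<open>i\<close> letters, exchanging \<open>w(i)\<close> and
  \<open>w(i+1)\<close> creates no forbidden pattern. Besides the column \<open>w(i)\<close>, whose polynomial gains
  the factor \<open>x\<^sub>i\<close>, only the columns of the letters after position \<open>i + 1\<close> with value
  between \<open>w(i)\<close> and \<open>w(i+1)\<close> are not symmetric in \<open>i, i + 1\<close>; two such
  letters would form a forbidden pattern with \<open>w(i)\<close> and \<open>w(i+1)\<close>.

  A common element of \<open>R\<close> and \<open>S\<close> may be removed without affecting \<open>R \<le> S\<close>.
  Hence \<open>C \<le> D(w)\<close> is augmented at \<open>k\<close> iff it agrees with \<open>D(w)\<close> in row
  \<open>k\<close> and column \<open>w(k)\<close>, and the diagrams that agree with \<open>D(w)\<close> at every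
  \<open>k \<in> K\<close> are counted by the principal specialization for the subword of \<open>w\<close> without the
  positions in \<open>K\<close>. The formula is then inclusion-exclusion over \<open>K\<close>.
\<close>

section \<open>The order on finite sets\<close>

text \<open>The list is increasing, so the indices of the entries up to \<open>t\<close> form an
  initial segment, of length \<open>card (A \<inter> {..t})\<close>.\<close>

lemma sorted_list_of_set_nth_le_iff:
  fixes A :: "nat set"
  assumes "finite A" "k < card A"
  shows "sorted_list_of_set A ! k \<le> t \<longleftrightarrow> k < card (A \<inter> {..t})"
proof -
  let ?xs = "sorted_list_of_set A"
  let ?J = "{i. i < card A \<and> ?xs ! i \<le> t}"
  have mono: "i \<le> j \<Longrightarrow> j < card A \<Longrightarrow> ?xs ! i \<le> ?xs ! j" for i j
    by (rule sorted_nth_mono) simp_all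
  have "inj_on ((!) ?xs) ?J"
    by (auto intro!: inj_onI simp: nth_eq_iff_index_eq)
  moreover have "(!) ?xs ` ?J = A \<inter> {..t}"
  proof -
    have "A = {?xs ! i |i. i < card A}"
      using set_conv_nth[of ?xs] assms(1) by simp
    then show ?thesis by auto
  qed
  ultimately have J: "card (A \<inter> {..t}) = card ?J"
    by (metis card_image)
  show ?thesis
  proof
    assume "?xs ! k \<le> t"
    then have "{..k} \<subseteq> ?J"
      using assms(2) mono[of _ k] by fastforce
    then have "card {..k} \<le> card ?J"
      by (intro card_mono) auto
    then show "k < card (A \<inter> {..t})"
      by (simp add: J)
  next
    assume k: "k < card (A \<inter> {..t})"
    show "?xs ! k \<le> t"
    proof (rule ccontr)
      assume "\<not> ?xs ! k \<le> t"
      then have "i < k" if "i \<in> ?J" for i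
        using that mono[of k i] by (cases "i < k") auto
      then have "?J \<subseteq> {..<k}"
        by blast
      then have "card ?J \<le> card {..<k}"
        by (intro card_mono) auto
      with k J show False by simp
    qed
  qed
qed

text \<open>Prefix counts are handier than sorted lists: they are additive over disjoint unions, and
  exchanging two neighbours disturbs only one of them.\<close>

lemma set_le_iff:
  assumes "finite R" "finite S"
  shows "set_le R S \<longleftrightarrow> card R = card S \<and> (\<forall>t. card (S \<inter> {..t}) \<le> card (R \<inter> {..t}))"
proof (cases "card R = card S")
  case True
  have "(\<forall>k<card R. sorted_list_of_set R ! k \<le> sorted_list_of_set S ! k) \<longleftrightarrow>
    (\<forall>t. card (S \<inter> {..t}) \<le> card (R \<inter> {..t}))" (is "?L \<longleftrightarrow> ?R")
  proof
    assume L: ?L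
    show ?R
    proof
      fix t
      show "card (S \<inter> {..t}) \<le> card (R \<inter> {..t})"
      proof (cases "card (S \<inter> {..t})")
        \<comment> \<open>\<open>k\<close> is the 0-based index of the largest element of
          \<open>S\<close> up to \<open>t\<close>.\<close>
        case (Suc k)
        have k: "k < card S"
          using Suc card_mono[OF assms(2), of "S \<inter> {..t}"] by simp
        then have "sorted_list_of_set S ! k \<le> t"
          using sorted_list_of_set_nth_le_iff[OF assms(2) k, of t] Suc by simp
        then have "sorted_list_of_set R ! k \<le> t"
          using L True k by fastforce
        then show ?thesis
          using sorted_list_of_set_nth_le_iff[OF assms(1), of k t] k True Suc by simp
      qed simp
    qed
  next
    assume R: ?R
    show ?L
    proof (intro allI impI)
      fix k assume k: "k < card R"
      then have "k < card (S \<inter> {..sorted_list_of_set S ! k})"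
        using sorted_list_of_set_nth_le_iff[OF assms(2), of k "sorted_list_of_set S ! k"] True by simp
      then have "k < card (R \<inter> {..sorted_list_of_set S ! k})"
        using R by (meson less_le_trans)
      then show "sorted_list_of_set R ! k \<le> sorted_list_of_set S ! k"
        using sorted_list_of_set_nth_le_iff[OF assms(1) k] by simp
    qed
  qed
  with True show ?thesis
    by (simp add: set_le_def)
qed (simp add: set_le_def)

lemma set_le_refl: "set_le S S"
  by (simp add: set_le_def)

text \<open>By additivity of prefix counts, the common part contributes equally to both sides and
  cancels.\<close>

lemma set_le_cong_common:
  assumes "finite R" "finite S" "R \<inter> K = S \<inter> K"
  shows "set_le (R - K) (S - K) \<longleftrightarrow> set_le R S"
proof -
  have split: "card (T \<inter> U) = card ((T - K) \<inter> U) + card (T \<inter> K \<inter> U)"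
    if "finite T" for T U :: "nat set"
    using that by (subst card_Un_disjoint[symmetric]) (auto intro: arg_cong[where f = card])
  have "card R = card S \<longleftrightarrow> card (R - K) = card (S - K)"
    using split[OF assms(1), of UNIV] split[OF assms(2), of UNIV] assms(3) by simp
  moreover have "card (S \<inter> {..t}) \<le> card (R \<inter> {..t}) \<longleftrightarrow>
      card ((S - K) \<inter> {..t}) \<le> card ((R - K) \<inter> {..t})" for t
    using split[OF assms(1), of "{..t}"] split[OF assms(2), of "{..t}"] assms(3) by simp
  ultimately show ?thesis
    using assms by (simp add: set_le_iff)
qed

text \<open>A strictly increasing map commutes with sorting, so it acts entry by entry on the sorted
  lists. This transports columns between a subword and its standardization.\<close>

lemma set_le_image_iff:
  assumes "strict_mono_on A f" "R \<subseteq> A" "S \<subseteq> A" "finite A"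
  shows "set_le (f ` R) (f ` S) \<longleftrightarrow> set_le R S"
proof -
  have list: "sorted_list_of_set (f ` T) = map f (sorted_list_of_set T)" if "T \<subseteq> A" for T
  proof (rule strict_sorted_equal)
    have T: "finite T"
      using that assms(4) by (rule finite_subset)
    show "sorted_wrt (<) (map f (sorted_list_of_set T))"
      unfolding sorted_wrt_map
      by (rule sorted_wrt_mono_rel[OF _ strict_sorted_list_of_set[of T]])
        (use T that assms(1) in \<open>auto dest: strict_mono_onD\<close>)
    show "set (sorted_list_of_set (f ` T)) = set (map f (sorted_list_of_set T))"
      using T by simp
  qed simp
  have card: "card (f ` T) = card T" if "T \<subseteq> A" for T
    using assms(1) that by (intro card_image) (metis inj_on_subset strict_mono_on_imp_inj_on)
  have RS: "finite R" "finite S"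
    using assms(2-4) finite_subset by auto
  have le: "f x \<le> f y \<longleftrightarrow> x \<le> y" if "x \<in> R" "y \<in> S" for x y
    using that assms(1-3) by (metis linorder_not_less strict_mono_onD order_less_imp_le le_less subsetD)
  have "f (sorted_list_of_set R ! t) \<le> f (sorted_list_of_set S ! t) \<longleftrightarrow>
      sorted_list_of_set R ! t \<le> sorted_list_of_set S ! t" if "t < card R" "card R = card S" for t
  proof (rule le)
    show "sorted_list_of_set R ! t \<in> R"
      using nth_mem[of t "sorted_list_of_set R"] that RS by simp
    show "sorted_list_of_set S ! t \<in> S"
      using nth_mem[of t "sorted_list_of_set S"] that RS by simp
  qed
  then show ?thesis
    using assms by (auto simp: set_le_def list card)
qed

section \<open>Sets below a given column\<close>

text \<open>The inclusion excludes row 0 and infinite sets, whose \<open>card\<close> is 0.\<close>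

definition below :: "nat \<Rightarrow> nat set \<Rightarrow> nat set set" where
  "below n S = {R. R \<subseteq> {1..n} \<and> set_le R S}"

text \<open>The prefix count of \<open>{1..<m}\<close> at \<open>m - 1\<close> is already its
  cardinality, which forces every element of \<open>R\<close> to be at most
  \<open>m - 1\<close>.\<close>

lemma below_initial:
  assumes "m \<le> Suc n"
  shows "below n {1..<m} = {{1..<m}}"
proof
  show "{{1..<m}} \<subseteq> below n {1..<m}"
    using assms by (auto simp: below_def set_le_refl)
  show "below n {1..<m} \<subseteq> {{1..<m}}"
  proof
    fix R assume "R \<in> below n {1..<m}"
    then have R: "R \<subseteq> {1..n}" "set_le R {1..<m}" and fin: "finite R"
      by (auto simp: below_def finite_subset)
    then have card: "card R = m - 1" "card ({1..<m} \<inter> {..m - 1}) \<le> card (R \<inter> {..m - 1})"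
      by (auto simp: set_le_iff)
    have "{1..<m} \<inter> {..m - 1} = {1..<m}"
      by auto
    with card have "card R \<le> card (R \<inter> {..m - 1})"
      by simp
    then have "R \<inter> {..m - 1} = R"
      using fin card_seteq[of R "R \<inter> {..m - 1}"] by auto
    then have "R \<subseteq> {1..<m}"
      using R(1) by fastforce
    then show "R \<in> {{1..<m}}"
      using card(1) card_subset_eq[of "{1..<m}" R] by auto
  qed
qed

section \<open>Evaluation and divided differences\<close>

lemma update_eq_add_single:
  fixes f :: "'a \<Rightarrow>\<^sub>0 'b :: monoid_add"
  assumes "m \<notin> Poly_Mapping.keys f"
  shows "Poly_Mapping.update m c f = f + Poly_Mapping.single m c"
  using assms
  by (intro poly_mapping_eqI)
    (auto simp: lookup_update lookup_add lookup_single when_def in_keys_iff)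

lemma poly_mapping_add_induct [case_names zero add]:
  fixes P :: "('a \<Rightarrow>\<^sub>0 'b :: monoid_add) \<Rightarrow> bool"
  assumes "P 0" and "\<And>f m c. P f \<Longrightarrow> P (f + Poly_Mapping.single m c)"
  shows "P f"
proof (induction f rule: update_induct)
  case (update f a b)
  then show ?case
    using assms(2) by (simp add: update_eq_add_single)
qed (rule assms(1))

lemma swap_vars_0 [simp]: "swap_vars i 0 = 0"
  by (simp add: swap_vars_def map_key_zero[OF inj_map_key_transpose])

lemma swap_vars_1 [simp]: "swap_vars i 1 = 1"
  by (simp add: swap_vars_single map_key_zero flip: single_one)

lemma swap_vars_mult: "swap_vars i (f * g) = swap_vars i f * swap_vars i g"
proof (induction f rule: poly_mapping_add_induct)
  case (add f m c)
  have "swap_vars i (Poly_Mapping.single m c * g) =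
      swap_vars i (Poly_Mapping.single m c) * swap_vars i g"
    by (induction g rule: poly_mapping_add_induct)
      (simp_all add: swap_vars_single swap_vars_add distrib_left mult_single map_key_plus)
  with add show ?case
    by (simp add: swap_vars_add distrib_right)
qed simp

lemma swap_vars_sum: "swap_vars i (\<Sum>x\<in>A. f x) = (\<Sum>x\<in>A. swap_vars i (f x))"
  by (induction A rule: infinite_finite_induct) (simp_all add: swap_vars_add)

lemma swap_vars_prod: "swap_vars i (\<Prod>x\<in>A. f x) = (\<Prod>x\<in>A. swap_vars i (f x))"
  by (induction A rule: infinite_finite_induct) (simp_all add: swap_vars_mult)

lemma swap_vars_var: "swap_vars i (var j) = var (transpose i (Suc i) j)"
proof -
  have "Poly_Mapping.map_key (transpose i (Suc i)) (Poly_Mapping.single j (1::nat)) =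
      Poly_Mapping.single (transpose i (Suc i) j) 1"
    by (rule poly_mapping_eqI)
      (auto simp: Poly_Mapping.map_key.rep_eq lookup_single when_def)
  then show ?thesis
    by (simp add: var_def swap_vars_single)
qed

text \<open>The quotient is unique, because the nonzero factor \<open>var i - var (Suc i)\<close>
  can be cancelled.\<close>

lemma divided_difference_eqI:
  assumes "(var i - var (Suc i)) * g = f - swap_vars i f"
  shows "divided_difference i f = g"
proof -
  have "Poly_Mapping.lookup (Poly_Mapping.single (Suc i) (1::nat)) i \<noteq>
      Poly_Mapping.lookup (Poly_Mapping.single i 1) i"
    by (simp add: lookup_single)
  then have ne: "Poly_Mapping.single (Suc i) (1::nat) \<noteq> Poly_Mapping.single i 1" by metis
  have "var i \<noteq> var (Suc i)"
  proof
    assume "var i = var (Suc i)"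
    then have "Poly_Mapping.lookup (var i) (Poly_Mapping.single i 1) =
        Poly_Mapping.lookup (var (Suc i)) (Poly_Mapping.single i 1)" by simp
    with ne show False
      by (simp add: var_def lookup_single when_def)
  qed
  then show ?thesis
    using assms divided_difference_mult[of i f] by (metis mult_left_cancel right_minus_eq)
qed

section \<open>Evaluation at all ones as a ring homomorphism\<close>

lemma eval_poly_1: "eval_poly f (\<lambda>_. 1) = (\<Sum>m\<in>Poly_Mapping.keys f. Poly_Mapping.lookup f m)"
  by (simp add: eval_poly_def)

lemma eval_poly_1_add:
  "eval_poly (f + g) (\<lambda>_. 1) = eval_poly f (\<lambda>_. 1) + eval_poly g (\<lambda>_. 1)"
proof -
  let ?K = "Poly_Mapping.keys f \<union> Poly_Mapping.keys g"
  \<comment> \<open>Zero coefficients allow all three sums to run over one index set.\<close>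
  have eval: "eval_poly h (\<lambda>_. 1) = (\<Sum>m\<in>?K. Poly_Mapping.lookup h m)"
    if "Poly_Mapping.keys h \<subseteq> ?K" for h
    unfolding eval_poly_1 using that by (intro sum.mono_neutral_left) (auto simp: in_keys_iff)
  show ?thesis
    using keys_add[of f g] by (simp add: eval lookup_add sum.distrib)
qed

lemma eval_poly_1_single: "eval_poly (Poly_Mapping.single m c) (\<lambda>_. 1) = c"
  by (simp add: eval_poly_1)

lemma eval_poly_1_0: "eval_poly 0 (\<lambda>_. 1) = 0"
  by (simp add: eval_poly_1)

lemma eval_poly_1_mult:
  "eval_poly (f * g) (\<lambda>_. 1) = eval_poly f (\<lambda>_. 1) * eval_poly g (\<lambda>_. 1)"
proof (induction f rule: poly_mapping_add_induct)
  case (add f m c)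
  have "eval_poly (Poly_Mapping.single m c * g) (\<lambda>_. 1) = c * eval_poly g (\<lambda>_. 1)"
    by (induction g rule: poly_mapping_add_induct)
      (simp_all add: eval_poly_1_add eval_poly_1_single eval_poly_1_0 distrib_left mult_single)
  with add show ?case
    by (simp add: eval_poly_1_add eval_poly_1_single distrib_right)
qed (simp add: eval_poly_1_0)

lemma eval_poly_1_sum:
  "eval_poly (\<Sum>x\<in>A. f x) (\<lambda>_. 1) = (\<Sum>x\<in>A. eval_poly (f x) (\<lambda>_. 1))"
  by (induction A rule: infinite_finite_induct) (simp_all add: eval_poly_1_add eval_poly_1_0)

lemma eval_poly_1_prod:
  "eval_poly (\<Prod>x\<in>A. f x) (\<lambda>_. 1) = (\<Prod>x\<in>A. eval_poly (f x) (\<lambda>_. 1))"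
proof -
  have "eval_poly 1 (\<lambda>_. 1) = 1"
    using eval_poly_1_single[of 0 1] by simp
  then show ?thesis
    by (induction A rule: infinite_finite_induct) (simp_all add: eval_poly_1_mult)
qed

section \<open>Column polynomials\<close>

text \<open>For \<open>S \<subseteq> {1..n}\<close> this is the key polynomial of the 0/1
  composition with support \<open>S\<close>.\<close>

definition column_poly :: "nat \<Rightarrow> nat set \<Rightarrow> mpoly_int" where
  "column_poly n S = (\<Sum>R\<in>below n S. \<Prod>r\<in>R. var r)"

lemma eval_column_poly: "eval_poly (column_poly n S) (\<lambda>_. 1) = int (card (below n S))"
proof -
  have "eval_poly (var r) (\<lambda>_. 1) = 1" for r
    by (simp add: var_def eval_poly_1_single)
  then show ?thesis
    by (simp add: column_poly_def eval_poly_1_sum eval_poly_1_prod)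
qed

lemma column_poly_initial: "m \<le> Suc n \<Longrightarrow> column_poly n {1..<m} = (\<Prod>r\<in>{1..<m}. var r)"
  unfolding column_poly_def by (subst below_initial) simp_all

lemma swap_vars_monomial:
  "swap_vars i (\<Prod>r\<in>R. var r) = (\<Prod>r\<in>transpose i (Suc i) ` R. var r)"
  by (simp add: swap_vars_prod swap_vars_var prod.reindex[OF inj_on_transpose])

text \<open>The prefix condition at \<open>i\<close> is the only one that the transposition of \<open>i\<close> and
  \<open>i + 1\<close> can affect; it follows from its neighbours unless \<open>i \<in> S\<close> and \<open>i + 1 \<notin> S\<close>.\<close>

definition below_except :: "nat \<Rightarrow> nat \<Rightarrow> nat set \<Rightarrow> nat set set" where
  "below_except n i S = {R. R \<subseteq> {1..n} \<and> card R = card S \<and>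
     (\<forall>t. t \<noteq> i \<longrightarrow> card (S \<inter> {..t}) \<le> card (R \<inter> {..t}))}"

lemma card_Int_atMost_Suc:
  fixes R :: "nat set"
  shows "card (R \<inter> {..Suc i}) = card (R \<inter> {..i}) + (if Suc i \<in> R then 1 else 0)"
  by (simp add: atMost_Suc)

lemma card_Int_atMost_pred:
  fixes R :: "nat set"
  assumes "1 \<le> i"
  shows "card (R \<inter> {..i}) = card (R \<inter> {..i - 1}) + (if i \<in> R then 1 else 0)"
  using card_Int_atMost_Suc[of R "i - 1"] assms by simp

lemma below_eq_below_except:
  assumes "S \<subseteq> {1..n}"
  shows "below n S = {R \<in> below_except n i S. card (S \<inter> {..i}) \<le> card (R \<inter> {..i})}"
proof -
  have "set_le R S \<longleftrightarrow> card R = card S \<and> (\<forall>t. card (S \<inter> {..t}) \<le> card (R \<inter> {..t}))"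
    if "R \<subseteq> {1..n}" for R
    using that assms by (intro set_le_iff) (auto intro: finite_subset)
  then show ?thesis
    by (auto simp: below_def below_except_def) metis
qed

text \<open>The transposition preserves \<open>{..t}\<close> for every \<open>t \<noteq> i\<close>,
  hence all prefix counts that the family constrains; it is an involution.\<close>

lemma transpose_image_below_except:
  assumes "1 \<le> i" "i < n"
  shows "(`) (transpose i (Suc i)) ` below_except n i S = below_except n i S"
proof -
  let ?s = "transpose i (Suc i)"
  have card_im: "card (?s ` R) = card R" for R
    by (intro card_image inj_on_transpose)
  have pre: "card (?s ` R \<inter> {..t}) = card (R \<inter> {..t})" if "t \<noteq> i" for R t
  proof -
    have "?s x \<le> t \<longleftrightarrow> x \<le> t" for x
      using that by (auto simp: transpose_def)
    then have "?s ` R \<inter> {..t} = ?s ` (R \<inter> {..t})"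
      by auto
    then show ?thesis
      by (simp add: card_im)
  qed
  have sub: "?s ` R \<subseteq> {1..n}" if "R \<subseteq> {1..n}" for R
    using that assms by (auto simp: transpose_def)
  have "?s ` R \<in> below_except n i S" if "R \<in> below_except n i S" for R
    using that sub[of R] by (simp add: below_except_def card_im pre)
  moreover have "?s ` ?s ` R = R" for R
    by (simp add: image_image)
  ultimately show ?thesis
    by (metis (no_types, lifting) image_eqI image_subsetI subsetI subset_antisym)
qed

lemma swap_vars_sum_below_except:
  assumes "1 \<le> i" "i < n"
  shows "swap_vars i (\<Sum>R\<in>below_except n i S. \<Prod>r\<in>R. var r) =
    (\<Sum>R\<in>below_except n i S. \<Prod>r\<in>R. var r)"
proof -
  let ?s = "transpose i (Suc i)"
  have "inj_on ((`) ?s) (below_except n i S)"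
    by (rule inj_on_inverseI[where g = "(`) ?s"]) (simp add: image_image)
  then have "(\<Sum>R\<in>below_except n i S. \<Prod>r\<in>?s ` R. var r) =
      (\<Sum>R\<in>(`) ?s ` below_except n i S. \<Prod>r\<in>R. var r)"
    by (simp add: sum.reindex)
  then show ?thesis
    using assms by (simp add: swap_vars_sum swap_vars_monomial transpose_image_below_except)
qed

text \<open>If \<open>i \<notin> S\<close>, the condition at \<open>i - 1\<close> implies the one at
  \<open>i\<close>; if \<open>i\<close> and \<open>i + 1\<close> both lie in \<open>S\<close>, the
  condition at \<open>i + 1\<close> does, as the count of \<open>R\<close> grows by at most
  1.\<close>

lemma below_eq_below_except':
  assumes "S \<subseteq> {1..n}" "1 \<le> i" "i \<in> S \<Longrightarrow> Suc i \<in> S"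
  shows "below n S = below_except n i S"
proof -
  have "card (S \<inter> {..i}) \<le> card (R \<inter> {..i})" if "R \<in> below_except n i S" for R
  proof -
    have "card (S \<inter> {..Suc i}) \<le> card (R \<inter> {..Suc i})"
      "card (S \<inter> {..i - 1}) \<le> card (R \<inter> {..i - 1})"
      using that assms(2) by (auto simp: below_except_def)
    then show ?thesis
      using assms(3) card_Int_atMost_pred[OF assms(2), of S] card_Int_atMost_pred[OF assms(2), of R]
      by (auto simp: card_Int_atMost_Suc split: if_splits)
  qed
  then show ?thesis
    unfolding below_eq_below_except[OF assms(1), of i] by blast
qed

lemma swap_vars_column_poly:
  assumes "S \<subseteq> {1..n}" "1 \<le> i" "i < n" "i \<in> S \<Longrightarrow> Suc i \<in> S"
  shows "swap_vars i (column_poly n S) = column_poly n S"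
  using assms by (simp add: column_poly_def below_eq_below_except' swap_vars_sum_below_except)

text \<open>Moving an element from \<open>i\<close> to \<open>i + 1\<close> changes only the prefix
  count at \<open>i\<close>, which is left unconstrained.\<close>

lemma below_except_insert:
  assumes "S \<subseteq> {1..n}" "i \<in> S" "Suc i \<notin> S"
  shows "below_except n i (insert (Suc i) (S - {i})) = below_except n i S"
proof -
  have fin: "finite S"
    using assms(1) by (rule finite_subset) simp
  have S': "insert (Suc i) (S - {i}) = transpose i (Suc i) ` S"
    using assms(2,3) by (auto simp: transpose_def)
  let ?S' = "insert (Suc i) (S - {i})"
  have "card (?S' \<inter> {..t}) = card (S \<inter> {..t})" if "t \<noteq> i" for t
  proof (cases "t < i")
    case True
    then have "?S' \<inter> {..t} = S \<inter> {..t}" by auto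
    then show ?thesis by simp
  next
    case False
    then have "?S' \<inter> {..t} = insert (Suc i) (S \<inter> {..t} - {i})" "i \<in> S \<inter> {..t}"
      using that assms(2) by auto
    then show ?thesis
      using assms(3) fin card.remove[of "S \<inter> {..t}" i] by simp
  qed
  moreover have "card ?S' = card S"
    using assms fin card.remove[of S i] by simp
  ultimately show ?thesis
    by (simp add: below_except_def)
qed

text \<open>The Demazure operator \<open>f \<mapsto> \<partial>\<^sub>i (x\<^sub>i f)\<close> moves a box of the column from
  row \<open>i\<close> to row \<open>i + 1\<close>. The sets missing on one side contain \<open>i + 1\<close> but not
  \<open>i\<close>, so that their contribution to the right-hand side cancels.\<close>

lemma column_poly_shift:
  assumes "S \<subseteq> {1..n}" "1 \<le> i" "i < n" "i \<in> S" "Suc i \<notin> S"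
  shows "(var i - var (Suc i)) * column_poly n (insert (Suc i) (S - {i})) =
    var i * column_poly n S - var (Suc i) * swap_vars i (column_poly n S)"
proof -
  let ?S' = "insert (Suc i) (S - {i})"
  let ?Q = "below_except n i S"
  let ?B = "{R \<in> ?Q. card (R \<inter> {..i}) < card (S \<inter> {..i})}"
  let ?x = "\<lambda>R. \<Prod>r\<in>R. var r"
  have finQ: "finite ?Q"
    by (rule finite_subset[of _ "Pow {1..n}"]) (auto simp: below_except_def)
  have "below n ?S' = below_except n i ?S'"
    using assms by (intro below_eq_below_except') auto
  also have "\<dots> = ?Q"
    using assms by (intro below_except_insert)
  finally have P': "column_poly n ?S' = sum ?x ?Q"
    by (simp add: column_poly_def)
  have "below n S = ?Q - ?B"
    unfolding below_eq_below_except[OF assms(1), of i] by fastforce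
  then have P: "column_poly n S = sum ?x ?Q - sum ?x ?B"
    unfolding column_poly_def using finQ by (simp add: sum_diff)
  \<comment> \<open>The condition holds at \<open>i - 1\<close> and \<open>i + 1\<close> but fails
    at \<open>i\<close>. Since the count of \<open>S\<close> grows at \<open>i\<close> and not at
    \<open>i + 1\<close>, that of \<open>R\<close> must do the opposite.\<close>
  have B: "i \<notin> R" "Suc i \<in> R" "finite R" if "R \<in> ?B" for R
  proof -
    have "card (S \<inter> {..Suc i}) \<le> card (R \<inter> {..Suc i})"
      "card (S \<inter> {..i - 1}) \<le> card (R \<inter> {..i - 1})"
      "card (R \<inter> {..i}) < card (S \<inter> {..i})"
      using that assms(2) by (auto simp: below_except_def)
    then show "i \<notin> R" "Suc i \<in> R"
      using assms(4,5) card_Int_atMost_pred[OF assms(2), of S]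
        card_Int_atMost_pred[OF assms(2), of R]
      by (auto simp: card_Int_atMost_Suc split: if_splits)
    show "finite R"
      using that finite_subset[of R "{1..n}"] by (simp add: below_except_def)
  qed
  \<comment> \<open>Both sides are \<open>var i * var (Suc i)\<close> times the monomial of
    \<open>R - {Suc i}\<close>, which contains neither variable.\<close>
  have cancel: "var i * ?x R = var (Suc i) * swap_vars i (?x R)" if "R \<in> ?B" for R
  proof -
    let ?T = "R - {Suc i}"
    have "swap_vars i (?x ?T) = ?x ?T"
      unfolding swap_vars_monomial using B(1)[OF that]
      by (intro arg_cong[where f = ?x]) (auto simp: transpose_def image_iff)
    moreover have "?x R = var (Suc i) * ?x ?T"
      using B[OF that] by (simp add: prod.remove)
    ultimately show ?thesis
      by (simp add: swap_vars_mult swap_vars_var mult.left_commute)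
  qed
  have swapQ: "swap_vars i (sum ?x ?Q) = sum ?x ?Q"
    using assms by (intro swap_vars_sum_below_except)
  have "swap_vars i (sum ?x ?Q) = swap_vars i (column_poly n S) + swap_vars i (sum ?x ?B)"
    unfolding P by (simp flip: swap_vars_add)
  then have swapP: "swap_vars i (column_poly n S) = sum ?x ?Q - swap_vars i (sum ?x ?B)"
    using swapQ by simp
  have "var i * sum ?x ?B = var (Suc i) * swap_vars i (sum ?x ?B)"
    using cancel by (simp add: swap_vars_sum sum_distrib_left)
  then show ?thesis
    unfolding P' swapP unfolding P by (simp add: algebra_simps)
qed

section \<open>Factorization of Schubert polynomials\<close>

text \<open>The order of \<open>c\<close> and \<open>d\<close> is left open, so one condition covers
  both patterns.\<close>

definition avoids_1432_1423 :: "nat \<Rightarrow> (nat \<Rightarrow> nat) \<Rightarrow> bool" where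
  "avoids_1432_1423 n w \<longleftrightarrow> (\<forall>a b c d. 1 \<le> a \<and> a < b \<and> b < c \<and> b < d \<and> c \<noteq> d \<and>
     c \<le> n \<and> d \<le> n \<and> w a < w c \<and> w a < w d \<longrightarrow> \<not> (w c < w b \<and> w d < w b))"

lemma avoids_1432_1423D:
  "avoids_1432_1423 n w \<Longrightarrow> 1 \<le> a \<Longrightarrow> a < b \<Longrightarrow> b < c \<Longrightarrow> b < d \<Longrightarrow> c \<le> n \<Longrightarrow> d \<le> n \<Longrightarrow>
    w a < w c \<Longrightarrow> w a < w d \<Longrightarrow> w c < w b \<Longrightarrow> w d < w b \<Longrightarrow> c = d"
  unfolding avoids_1432_1423_def by blast

text \<open>Columns are indexed by positions: \<open>p\<close> stands for the column \<open>w p\<close>.\<close>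

definition rothe_column :: "(nat \<Rightarrow> nat) \<Rightarrow> nat \<Rightarrow> nat set" where
  "rothe_column w p = {a \<in> {1..<p}. w p < w a}"

lemma column_rothe:
  assumes "w permutes {1..n}" "p \<in> {1..n}"
  shows "column (rothe n w) (w p) = rothe_column w p"
proof -
  have "w p \<in> {1..n}"
    using assms by (simp only: permutes_in_image)
  moreover have "inv w (w p) = p"
    using assms(1) by (rule permutes_inverses(2))
  ultimately show ?thesis
    using assms(2) by (auto simp: column_def rothe_def rothe_column_def)
qed

text \<open>\<open>x r\<close> occurs in the factors with \<open>p > r\<close>, of which there are
  \<open>n - r\<close>. This is the staircase monomial of the longest element.\<close>

lemma prod_initial_monomials:
  fixes x :: "nat \<Rightarrow> 'a :: comm_monoid_mult"
  shows "(\<Prod>p\<in>{1..n}. \<Prod>r\<in>{1..<p}. x r) = (\<Prod>r\<in>{1..n}. x r ^ (n - r))"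
proof (induction n)
  case (Suc n)
  have "(\<Prod>r\<in>{1..n}. x r ^ (Suc n - r)) = (\<Prod>r\<in>{1..n}. x r) * (\<Prod>r\<in>{1..n}. x r ^ (n - r))"
    by (simp add: Suc_diff_le flip: prod.distrib)
  with Suc show ?case
    by (simp add: atLeastLessThanSuc_atLeastAtMost mult.commute)
qed simp

lemma decreasing_prefix:
  fixes w :: "nat \<Rightarrow> nat"
  assumes "\<And>j. 1 \<le> j \<Longrightarrow> j < i \<Longrightarrow> w (Suc j) < w j" "1 \<le> a" "a < b" "b \<le> i"
  shows "w b < w a"
  using assms(3,4)
proof (induction b)
  case (Suc b)
  then show ?case
    using assms(1)[of b] assms(2) by (cases "a = b") auto
qed simp

text \<open>The transposition carries a forbidden occurrence back to \<open>w\<close> unless it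
  reverses two of its positions, which must then be \<open>i\<close> and \<open>i + 1\<close>.
  Reversing \<open>c\<close> and \<open>d\<close> is harmless; the other pairs are
  impossible.\<close>

lemma avoids_1432_1423_swap:
  assumes avoid: "avoids_1432_1423 n w" and i: "is_ascent n w i"
    and min: "\<And>a. 1 \<le> a \<Longrightarrow> a < i \<Longrightarrow> w i < w a"
  shows "avoids_1432_1423 n (w \<circ> transpose i (Suc i))"
  unfolding avoids_1432_1423_def
proof (intro allI impI notI; elim conjE)
  let ?s = "transpose i (Suc i)" and ?v = "w \<circ> transpose i (Suc i)"
  fix a b c d
  assume *: "1 \<le> a" "a < b" "b < c" "b < d" "c \<noteq> d" "c \<le> n" "d \<le> n"
    "?v a < ?v c" "?v a < ?v d" "?v c < ?v b" "?v d < ?v b"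
  have i': "1 \<le> i" "i < n" "w i < w (Suc i)"
    using i by (auto simp: is_ascent_def)
  have order: "?s x < ?s y" if "x < y" "\<not> (x = i \<and> y = Suc i)" for x y
    using that by (auto simp: transpose_def)
  \<comment> \<open>\<open>?v\<close> descends at \<open>i\<close>, whereas the occurrence ascends
    from \<open>a\<close> to \<open>b\<close>.\<close>
  have "?s a < ?s b"
    using * i' by (intro order) auto
  moreover have "?s b < ?s x" if "b < x" "?v a < ?v x" for x
  proof (rule order)
    \<comment> \<open>Here \<open>?v x\<close> would be \<open>w i\<close>, smaller than all earlier
      letters, in particular than \<open>?v a\<close>.\<close>
    show "\<not> (b = i \<and> x = Suc i)"
    proof
      assume bx: "b = i \<and> x = Suc i"
      then have "?v a = w a" "?v x = w i"
        using *(2) by (auto simp: transpose_def)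
      then show False
        using min[of a] * bx that by simp
    qed
  qed fact
  moreover have "?s x \<le> n" if "x \<le> n" for x
    using that i' by (auto simp: transpose_def)
  moreover have "1 \<le> ?s a"
    using *(1) i' by (auto simp: transpose_def)
  moreover have "?s c \<noteq> ?s d"
    using *(5) by (metis transpose_involutory)
  ultimately show False
    using avoids_1432_1423D[OF avoid, of "?s a" "?s b" "?s c" "?s d"] * by simp
qed

lemma divided_difference_columns:
  assumes w: "w permutes {1..n}" and avoid: "avoids_1432_1423 n w" and i: "is_ascent n w i"
    and min: "\<And>a. 1 \<le> a \<Longrightarrow> a < i \<Longrightarrow> w i < w a"
  shows "divided_difference i (\<Prod>p\<in>{1..n}. column_poly n (rothe_column (w \<circ> transpose i (Suc i)) p))
    = (\<Prod>p\<in>{1..n}. column_poly n (rothe_column w p))"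
proof (rule divided_difference_eqI)
  let ?s = "transpose i (Suc i)" and ?v = "w \<circ> transpose i (Suc i)"
  let ?C = "rothe_column w" and ?P = "column_poly n"
  \<comment> \<open>\<open>M\<close> collects the later positions whose column contains
    \<open>i + 1\<close> but not \<open>i\<close>.\<close>
  define M where "M = {p \<in> {Suc (Suc i)..n}. w i < w p \<and> w p < w (Suc i)}"
  define N where "N = {1..n} - {i, Suc i} - M"
  define X where "X = (\<Prod>r\<in>{1..<i}. var r)"
  define G where "G = ?P (?C (Suc i)) * (\<Prod>p\<in>N. ?P (?C p))"
  have i': "1 \<le> i" "i < n" "w i < w (Suc i)"
    using i by (auto simp: is_ascent_def)
  have inj: "w x = w y \<longleftrightarrow> x = y" for x y
    using permutes_inj[OF w] by (simp add: inj_eq)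
  have split: "(\<Prod>p\<in>{1..n}. f p) = f i * (f (Suc i) * (\<Prod>p\<in>N. f p)) * (\<Prod>p\<in>M. f p)"
    for f :: "nat \<Rightarrow> mpoly_int"
  proof -
    have "{1..n} = insert i (insert (Suc i) (N \<union> M))"
      using i' by (auto simp: N_def M_def)
    moreover have "finite N" "finite M" "N \<inter> M = {}" "i \<notin> N \<union> M" "Suc i \<notin> N \<union> M"
      by (auto simp: N_def M_def)
    ultimately show ?thesis
      by (simp add: prod.union_disjoint mult_ac)
  qed
  have C_sub: "?C p \<subseteq> {1..n}" if "p \<in> {1..n}" for p
    using that by (auto simp: rothe_column_def)
  have Ci: "?C i = {1..<i}"
    using min by (auto simp: rothe_column_def)
  have Cv_i: "rothe_column ?v i = ?C (Suc i)"
    using i' by (auto simp: rothe_column_def transpose_def less_Suc_eq)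
  \<comment> \<open>The letter \<open>w i\<close> now sits one place later, below a larger letter in
    row \<open>i\<close>; the new box supplies the factor \<open>var i\<close>.\<close>
  have Cv_Suc: "rothe_column ?v (Suc i) = {1..<Suc i}"
    using i' min by (auto simp: rothe_column_def transpose_def less_Suc_eq)
  have Cv: "rothe_column ?v p = ?s ` ?C p" if "p \<noteq> i" "p \<noteq> Suc i" for p
  proof -
    have "a \<in> rothe_column ?v p \<longleftrightarrow> ?s a \<in> ?C p" for a
      using that i' by (auto simp: rothe_column_def transpose_def)
    moreover have "?s a \<in> ?C p \<longleftrightarrow> a \<in> ?s ` ?C p" for a
      by (metis (no_types, lifting) image_iff transpose_involutory)
    ultimately show ?thesis
      by blast
  qed
  have N: "p \<in> {1..n}" "p \<noteq> i" "p \<noteq> Suc i" "i \<in> ?C p \<longleftrightarrow> Suc i \<in> ?C p" if "p \<in> N" for p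
    using that i' inj[of p i] inj[of p "Suc i"]
    by (auto simp: N_def M_def rothe_column_def)
  have N_image: "?s ` ?C p = ?C p" if "p \<in> N" for p
    using N(4)[OF that] by (simp add: transpose_image_eq)
  have swap_N: "swap_vars i (?P (?C p)) = ?P (?C p)" if "p \<in> N" for p
    using N[OF that] C_sub i' by (intro swap_vars_column_poly) auto
  have "swap_vars i (?P (?C (Suc i))) = ?P (?C (Suc i))"
    using i' C_sub[of "Suc i"] by (intro swap_vars_column_poly) (auto simp: rothe_column_def)
  with swap_N have swap_G: "swap_vars i G = G"
    by (simp add: G_def swap_vars_mult swap_vars_prod)
  have swap_X: "swap_vars i X = X"
    unfolding X_def swap_vars_prod swap_vars_var by (intro prod.cong) auto
  have Fw: "(\<Prod>p\<in>{1..n}. ?P (?C p)) = X * G * (\<Prod>p\<in>M. ?P (?C p))"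
    using i' unfolding split Ci by (simp only: column_poly_initial X_def G_def)
  have "(\<Prod>p\<in>N. ?P (rothe_column ?v p)) = (\<Prod>p\<in>N. ?P (?C p))"
    using N Cv N_image by (intro prod.cong) auto
  moreover have "(\<Prod>p\<in>M. ?P (rothe_column ?v p)) = (\<Prod>p\<in>M. ?P (?s ` ?C p))"
    using Cv by (intro prod.cong) (auto simp: M_def)
  moreover have "?P {1..<Suc i} = X * var i"
    using i' column_poly_initial[of "Suc i" n] by (simp add: X_def)
  ultimately have Fv: "(\<Prod>p\<in>{1..n}. ?P (rothe_column ?v p)) =
      X * var i * G * (\<Prod>p\<in>M. ?P (?s ` ?C p))"
    unfolding split Cv_i Cv_Suc by (simp only: G_def mult_ac)
  \<comment> \<open>After the symmetric factors \<open>X\<close> and \<open>G\<close> are taken out,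
    the extra \<open>var i\<close> turns the divided difference into a Demazure operator on the
    columns of \<open>M\<close>.\<close>
  have shift: "(var i - var (Suc i)) * (\<Prod>p\<in>M. ?P (?C p)) = var i * (\<Prod>p\<in>M. ?P (?s ` ?C p))
      - var (Suc i) * swap_vars i (\<Prod>p\<in>M. ?P (?s ` ?C p))"
  proof (cases "M = {}")
    case False
    then obtain p where p: "p \<in> M"
      by blast
    \<comment> \<open>Two members of \<open>M\<close> would form a forbidden occurrence with the
      smaller letter at \<open>i\<close> and the larger one at \<open>i + 1\<close>.\<close>
    have "q = p" if "q \<in> M" for q
      using that p i' avoids_1432_1423D[OF avoid, of i "Suc i" q p] by (auto simp: M_def)
    with p have M: "M = {p}"
      by blast
    have ip: "i \<notin> ?C p" "Suc i \<in> ?C p" "p \<in> {1..n}"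
      using p i' by (auto simp: M_def rothe_column_def)
    have "insert (Suc i) (?s ` ?C p - {i}) = ?C p"
      using ip by (auto simp: transpose_def image_iff split: if_splits)
    moreover have "?s ` ?C p \<subseteq> {1..n}"
      using C_sub[OF ip(3)] i' by (auto simp: transpose_def)
    moreover have "i \<in> ?s ` ?C p" "Suc i \<notin> ?s ` ?C p"
      using ip by (auto simp: transpose_def image_iff)
    ultimately show ?thesis
      using column_poly_shift[of "?s ` ?C p" n i] i' by (simp add: M)
  qed simp
  have "(var i - var (Suc i)) * (\<Prod>p\<in>{1..n}. ?P (?C p)) =
      X * G * ((var i - var (Suc i)) * (\<Prod>p\<in>M. ?P (?C p)))"
    unfolding Fw by (simp only: mult_ac)
  also have "\<dots> = (\<Prod>p\<in>{1..n}. ?P (rothe_column ?v p)) -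
      swap_vars i (\<Prod>p\<in>{1..n}. ?P (rothe_column ?v p))"
    unfolding shift Fv by (simp add: swap_vars_mult swap_G swap_X swap_vars_var algebra_simps)
  finally show "(var i - var (Suc i)) * (\<Prod>p\<in>{1..n}. ?P (?C p)) =
      (\<Prod>p\<in>{1..n}. ?P (rothe_column ?v p)) - swap_vars i (\<Prod>p\<in>{1..n}. ?P (rothe_column ?v p))" .
qed

lemma schubert_eq_prod_rothe_column:
  assumes "w permutes {1..n}" "avoids_1432_1423 n w"
  shows "schubert n w = (\<Prod>p\<in>{1..n}. column_poly n (rothe_column w p))"
  using assms
proof (induction n w rule: schubert.induct)
  case (1 n w)
  have inj: "w x = w y \<longleftrightarrow> x = y" for x y
    using permutes_inj[OF "1.prems"(1)] by (simp add: inj_eq)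
  show ?case
  proof (cases "\<exists>i. is_ascent n w i")
    case True
    define i where "i = (LEAST i. is_ascent n w i)"
    have i: "is_ascent n w i"
      using True unfolding i_def by (rule LeastI_ex)
    then have i': "1 \<le> i" "i < n"
      by (auto simp: is_ascent_def)
    \<comment> \<open>There is no ascent before the least one, so \<open>w i\<close> is the minimum
      of the first \<open>i\<close> letters.\<close>
    have "w (Suc j) < w j" if "1 \<le> j" "j < i" for j
    proof -
      have "\<not> is_ascent n w j"
        using that(2) unfolding i_def by (rule not_less_Least)
      then show ?thesis
        using that i' inj[of j "Suc j"] by (auto simp: is_ascent_def)
    qed
    then have min: "w i < w a" if "1 \<le> a" "a < i" for a
      using that by (rule decreasing_prefix) auto
    let ?v = "w \<circ> transpose i (Suc i)"
    have "transpose i (Suc i) permutes {1..n}"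
      using i' by (intro permutes_swap_id) auto
    then have "?v permutes {1..n}"
      using "1.prems"(1) by (rule permutes_compose)
    then have "schubert n ?v = (\<Prod>p\<in>{1..n}. column_poly n (rothe_column ?v p))"
      using avoids_1432_1423_swap[OF "1.prems"(2) i min] "1.IH"[OF True i_def] by blast
    moreover have "schubert n w = divided_difference i (schubert n ?v)"
      using True by (subst schubert.simps) (simp add: Let_def i_def)
    ultimately show ?thesis
      using divided_difference_columns[OF "1.prems" i min] by simp
  next
    case False
    have "w (Suc j) < w j" if "1 \<le> j" "j < n" for j
      using that False inj[of j "Suc j"] by (auto simp: is_ascent_def)
    then have "w b < w a" if "1 \<le> a" "a < b" "b \<le> n" for a b
      using that by (rule decreasing_prefix) auto
    \<comment> \<open>For the decreasing permutation each column is full above its letter, so the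
      product is the staircase monomial.\<close>
    then have "rothe_column w p = {1..<p}" if "p \<in> {1..n}" for p
      using that by (auto simp: rothe_column_def)
    then have "(\<Prod>p\<in>{1..n}. column_poly n (rothe_column w p)) =
        (\<Prod>p\<in>{1..n}. \<Prod>r\<in>{1..<p}. var r)"
      using column_poly_initial[of _ n] by (intro prod.cong) auto
    then show ?thesis
      using False by (subst schubert.simps) (simp only: prod_initial_monomials if_False)
  qed
qed

lemma schubert_at_1:
  assumes "w permutes {1..n}" "avoids_1432_1423 n w"
  shows "eval_poly (schubert n w) (\<lambda>_. 1) =
    int (\<Prod>p\<in>{1..n}. card (below n (rothe_column w p)))"
  by (simp add: schubert_eq_prod_rothe_column[OF assms] eval_poly_1_prod eval_column_poly)

section \<open>Subwords\<close>

lemma sorted_list_of_set_eqI: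
  assumes "sorted_wrt (<) xs"
  shows "sorted_list_of_set (set xs) = (xs :: nat list)"
  using assms by (intro sorted_list_of_set.idem_if_sorted_distinct)
    (auto simp: strict_sorted_iff)

lemma subseq_one_line_iff:
  "subseq v (one_line n w) \<longleftrightarrow> (\<exists>I\<subseteq>{1..n}. v = map w (sorted_list_of_set I))"
proof
  assume "subseq v (one_line n w)"
  \<comment> \<open>\<open>J\<close> holds 0-based list indices; the entries of
    \<open>nths [1..<Suc n] J\<close> are the 1-based positions.\<close>
  then obtain J where J: "v = map w (nths [1..<Suc n] J)"
    by (auto simp: subseq_conv_nths one_line_def nths_map simp del: upt_Suc)
  let ?xs = "nths [1..<Suc n] J"
  have "sorted_wrt (<) ?xs"
    unfolding strict_sorted_iff by (simp add: sorted_nths distinct_nthsI del: upt_Suc)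
  then have "v = map w (sorted_list_of_set (set ?xs))"
    unfolding J by (simp only: sorted_list_of_set_eqI)
  moreover have "set ?xs \<subseteq> {1..n}"
    using set_nths_subset[of "[1..<Suc n]" J] by (simp add: atLeastLessThanSuc_atLeastAtMost del: upt_Suc)
  ultimately show "\<exists>I\<subseteq>{1..n}. v = map w (sorted_list_of_set I)"
    by blast
next
  assume "\<exists>I\<subseteq>{1..n}. v = map w (sorted_list_of_set I)"
  then obtain I where I: "I \<subseteq> {1..n}" "v = map w (sorted_list_of_set I)"
    by blast
  let ?xs = "filter (\<lambda>x. x \<in> I) [1..<Suc n]"
  have "set ?xs = I"
    using I(1) by auto
  moreover have "sorted_wrt (<) ?xs"
    by (intro sorted_wrt_filter) (simp del: upt_Suc)
  ultimately have "v = map w ?xs"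
    using I(2) sorted_list_of_set_eqI[of ?xs] by (simp del: upt_Suc)
  then show "subseq v (one_line n w)"
    unfolding one_line_def by (simp only: subseq_map subseq_filter_left)
qed

text \<open>Indexing by the deleted positions \<open>K\<close> makes the sign
  \<open>(- 1) ^ card K\<close>, as inclusion-exclusion requires.\<close>

lemma sum_subwords:
  assumes "inj w"
  shows "(\<Sum>v | subseq v (one_line n w). f v) =
    (\<Sum>K\<in>Pow {1..n}. f (map w (sorted_list_of_set ({1..n} - K))))"
proof (rule sum.reindex_bij_betw[symmetric, where h = "\<lambda>K. map w (sorted_list_of_set ({1..n} - K))"])
  let ?h = "\<lambda>K. map w (sorted_list_of_set ({1..n} - K))"
  have "K = L" if "K \<subseteq> {1..n}" "L \<subseteq> {1..n}" "?h K = ?h L" for K L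
  proof -
    have "sorted_list_of_set ({1..n} - K) = sorted_list_of_set ({1..n} - L)"
      using that(3) assms by (simp add: inj_map_eq_map)
    then have "set (sorted_list_of_set ({1..n} - K)) = set (sorted_list_of_set ({1..n} - L))"
      by (rule arg_cong)
    then show ?thesis
      using that(1,2) by auto
  qed
  moreover have "?h ` Pow {1..n} = {v. subseq v (one_line n w)}"
  proof
    show "?h ` Pow {1..n} \<subseteq> {v. subseq v (one_line n w)}"
      by (auto simp: subseq_one_line_iff)
    show "{v. subseq v (one_line n w)} \<subseteq> ?h ` Pow {1..n}"
    proof
      fix v assume "v \<in> {v. subseq v (one_line n w)}"
      then obtain I where "I \<subseteq> {1..n}" "v = map w (sorted_list_of_set I)"
        by (auto simp: subseq_one_line_iff)
      then show "v \<in> ?h ` Pow {1..n}"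
        by (intro image_eqI[where x = "{1..n} - I"]) (auto simp: double_diff)
    qed
  qed
  ultimately show "bij_betw ?h (Pow {1..n}) {v. subseq v (one_line n w)}"
    by (auto simp: bij_betw_def inj_on_def)
qed

lemma avoids_1432_1423I:
  assumes "w permutes {1..n}" "avoids_pattern (one_line n w) [1, 4, 3, 2]"
    "avoids_pattern (one_line n w) [1, 4, 2, 3]"
  shows "avoids_1432_1423 n w"
proof -
  have no: False if "1 \<le> a" "a < b" "b < c" "c < d" "d \<le> n"
    "w a < w c" "w a < w d" "w c < w b" "w d < w b" for a b c d
  proof -
    have "sorted_list_of_set {a, b, c, d} = [a, b, c, d]"
      using sorted_list_of_set_eqI[of "[a, b, c, d]"] that by simp
    then have sub: "subseq [w a, w b, w c, w d] (one_line n w)"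
      unfolding subseq_one_line_iff using that by (intro exI[of _ "{a, b, c, d}"]) auto
    have "w c \<noteq> w d"
      using that(4) permutes_inj[OF assms(1)] by (simp add: inj_eq)
    \<comment> \<open>Comparing the last two letters decides which of the two patterns
      occurs.\<close>
    then have "same_relative_order [w a, w b, w c, w d] [1, 4, 3, 2] \<or>
      same_relative_order [w a, w b, w c, w d] [1, 4, 2, 3]"
      using that by (cases "w c < w d")
        (auto simp: same_relative_order_def nth_Cons less_Suc_eq split: nat.splits)
    with sub assms(2,3) show False
      by (auto simp: avoids_pattern_def)
  qed
  show ?thesis
    unfolding avoids_1432_1423_def
  proof (intro allI impI notI; elim conjE)
    fix a b c d
    assume "1 \<le> a" "a < b" "b < c" "b < d" "c \<noteq> d" "c \<le> n" "d \<le> n"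
      "w a < w c" "w a < w d" "w c < w b" "w d < w b"
    then show False
      using no[of a b c d] no[of a b d c] by (cases "c < d") auto
  qed
qed

text \<open>The increasing enumeration \<open>f\<close> of \<open>I\<close> matches the columns of
  \<open>perm v\<close> with the traces on \<open>I\<close> of columns of \<open>w\<close>.
  Avoidance passes to subwords, so the product formula applies to \<open>perm v\<close>.\<close>

lemma schubert_perm_subword_at_1:
  assumes w: "w permutes {1..n}" "avoids_1432_1423 n w" and I: "I \<subseteq> {1..n}"
  defines "v \<equiv> map w (sorted_list_of_set I)"
  shows "eval_poly (schubert (length v) (perm v)) (\<lambda>_. 1) =
    int (\<Prod>p\<in>I. card {R. R \<subseteq> I \<and> set_le R (rothe_column w p \<inter> I)})"
proof -
  define m where "m = length v"
  define f where "f t = sorted_list_of_set I ! (t - 1)" for t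
  have fin: "finite I"
    using I by (rule finite_subset) simp
  have m: "m = card I"
    by (simp add: m_def v_def)
  have mono: "strict_mono_on {1..m} f"
  proof (rule strict_mono_onI)
    fix s t assume "s \<in> {1..m}" "t \<in> {1..m}" "s < t"
    then show "f s < f t"
      using sorted_wrt_nth_less[OF strict_sorted_list_of_set[of I], of "s - 1" "t - 1"]
      by (auto simp: f_def m)
  qed
  then have f_less: "f s < f t \<longleftrightarrow> s < t" if "s \<in> {1..m}" "t \<in> {1..m}" for s t
    using that by (metis linorder_neqE_nat order_less_asym strict_mono_onD)
  have inj: "inj_on f {1..m}"
    using mono by (rule strict_mono_on_imp_inj_on)
  have im: "f ` {1..m} = I"
  proof -
    have "f ` {1..m} = (!) (sorted_list_of_set I) ` {..<m}"
      unfolding f_def image_Suc_lessThan[symmetric] image_image by simp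
    also have "\<dots> = set (sorted_list_of_set I)"
      by (auto simp: m in_set_conv_nth image_iff)
    finally show ?thesis
      using fin by simp
  qed
  have v_nth: "v ! (t - 1) = w (f t)" if "t \<in> {1..m}" for t
    using that by (auto simp: v_def f_def m)
  have perm_less: "perm v s < perm v t \<longleftrightarrow> w (f s) < w (f t)"
    if "s \<in> {1..m}" "t \<in> {1..m}" for s t
  proof -
    have "w (f s) \<in> set v" "w (f t) \<in> set v"
      using that im fin by (auto simp: v_def)
    then show ?thesis
      using that rank_less_iff[of "set v" "w (f s)" "w (f t)"]
      unfolding perm_def m_def[symmetric] by (simp only: v_nth if_True finite_set)
  qed
  have "distinct v"
    using permutes_inj_on[OF w(1)] by (simp add: v_def distinct_map)
  then have perm: "perm v permutes {1..m}"
    unfolding m_def by (rule perm_permutes)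
  have "avoids_1432_1423 m (perm v)"
    unfolding avoids_1432_1423_def
  proof (intro allI impI notI; elim conjE)
    fix a b c d
    assume *: "1 \<le> a" "a < b" "b < c" "b < d" "c \<noteq> d" "c \<le> m" "d \<le> m"
      "perm v a < perm v c" "perm v a < perm v d" "perm v c < perm v b" "perm v d < perm v b"
    then have mem: "a \<in> {1..m}" "b \<in> {1..m}" "c \<in> {1..m}" "d \<in> {1..m}"
      by auto
    then have "f a \<in> {1..n}" "f b \<in> {1..n}" "f c \<in> {1..n}" "f d \<in> {1..n}"
      using im I by blast+
    then have "f c = f d"
      using * mem avoids_1432_1423D[OF w(2), of "f a" "f b" "f c" "f d"]
      by (simp add: perm_less f_less)
    then show False
      using inj mem *(5) by (simp add: inj_on_eq_iff)
  qed
  with perm have "eval_poly (schubert m (perm v)) (\<lambda>_. 1) =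
      int (\<Prod>t\<in>{1..m}. card (below m (rothe_column (perm v) t)))"
    by (rule schubert_at_1)
  also have "(\<Prod>t\<in>{1..m}. card (below m (rothe_column (perm v) t))) =
      (\<Prod>t\<in>{1..m}. card {R. R \<subseteq> I \<and> set_le R (rothe_column w (f t) \<inter> I)})"
  proof (rule prod.cong)
    fix t assume t: "t \<in> {1..m}"
    let ?T = "rothe_column (perm v) t"
    have T: "?T \<subseteq> {1..m}"
      using t by (auto simp: rothe_column_def)
    have "f ` ?T = rothe_column w (f t) \<inter> I"
    proof -
      have "s \<in> ?T \<longleftrightarrow> f s \<in> rothe_column w (f t)" if s: "s \<in> {1..m}" for s
      proof -
        have "f s \<in> {1..n}"
          using s im I by blast
        then show ?thesis
          using s t by (simp add: rothe_column_def f_less perm_less)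
      qed
      then show ?thesis
        using T im by blast
    qed
    moreover have "bij_betw ((`) f) (below m ?T) {R. R \<subseteq> I \<and> set_le R (f ` ?T)}"
    proof -
      have le: "set_le (f ` R) (f ` ?T) \<longleftrightarrow> set_le R ?T" if "R \<subseteq> {1..m}" for R
        using mono that T by (intro set_le_image_iff) auto
      have "inj_on ((`) f) (below m ?T)"
        using inj_on_image_Pow[OF inj] by (rule inj_on_subset) (auto simp: below_def)
      moreover have "(`) f ` below m ?T = {R. R \<subseteq> I \<and> set_le R (f ` ?T)}"
      proof
        show "(`) f ` below m ?T \<subseteq> {R. R \<subseteq> I \<and> set_le R (f ` ?T)}"
          using im le by (auto simp: below_def)
        show "{R. R \<subseteq> I \<and> set_le R (f ` ?T)} \<subseteq> (`) f ` below m ?T"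
        proof
          fix R assume R: "R \<in> {R. R \<subseteq> I \<and> set_le R (f ` ?T)}"
          then obtain R' where "R' \<subseteq> {1..m}" "R = f ` R'"
            using im by (auto simp: subset_image_iff)
          with R le show "R \<in> (`) f ` below m ?T"
            by (auto simp: below_def)
        qed
      qed
      ultimately show ?thesis
        by (simp add: bij_betw_def)
    qed
    ultimately show "card (below m ?T) =
        card {R. R \<subseteq> I \<and> set_le R (rothe_column w (f t) \<inter> I)}"
      using bij_betw_same_card by fastforce
  qed simp
  also have "\<dots> = (\<Prod>p\<in>f ` {1..m}. card {R. R \<subseteq> I \<and> set_le R (rothe_column w p \<inter> I)})"
    by (simp only: prod.reindex[OF inj] comp_def)
  finally show ?thesis
    by (simp only: im flip: m_def)
qed

section \<open>Augmented diagrams\<close>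

definition agrees_at :: "nat \<Rightarrow> (nat \<Rightarrow> nat) \<Rightarrow> nat \<Rightarrow> diagram \<Rightarrow> bool" where
  "agrees_at n w k C \<longleftrightarrow> (\<forall>j. (k, j) \<in> C \<longleftrightarrow> (k, j) \<in> rothe n w) \<and>
     (\<forall>i. (i, w k) \<in> C \<longleftrightarrow> (i, w k) \<in> rothe n w)"

lemma finite_column:
  assumes "is_diagram n D"
  shows "finite (column D j)"
  by (rule finite_subset[of _ "{1..n}"]) (use assms in \<open>auto simp: is_diagram_def column_def\<close>)

lemma is_diagram_rothe: "is_diagram n (rothe n w)"
  by (auto simp: is_diagram_def rothe_def)

lemma column_remove_row_col:
  "column (remove_row_col k l D) j = (if j = l then {} else column D j - {k})"
  by (auto simp: column_def remove_row_col_def)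

text \<open>For the converse the witness is \<open>C\<close> without row \<open>k\<close> and column
  \<open>w k\<close>. Column \<open>w k\<close> becomes empty on both sides; elsewhere at most the
  common element \<open>k\<close> is lost, which preserves the comparison.\<close>

lemma is_augmented_iff:
  assumes C: "is_diagram n C" "diagram_le n C (rothe n w)"
  shows "is_augmented n w C \<longleftrightarrow> (\<exists>k\<in>{1..n}. agrees_at n w k C)"
proof
  assume "is_augmented n w C"
  then show "\<exists>k\<in>{1..n}. agrees_at n w k C"
    unfolding is_augmented_def agrees_at_def augment_def by fast
next
  assume "\<exists>k\<in>{1..n}. agrees_at n w k C"
  then obtain k where k: "k \<in> {1..n}" "agrees_at n w k C" by blast
  let ?C = "remove_row_col k (w k) C"
  have "set_le (column C j - {k}) (column (rothe n w) j - {k})" if "j \<in> {1..n}" for j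
  proof -
    have "column C j \<inter> {k} = column (rothe n w) j \<inter> {k}"
      using k(2) by (auto simp: agrees_at_def column_def)
    then show ?thesis
      using that C finite_column[OF C(1)] finite_column[OF is_diagram_rothe]
      by (simp add: set_le_cong_common diagram_le_def)
  qed
  then have "diagram_le n ?C (remove_row_col k (w k) (rothe n w))"
    by (simp add: diagram_le_def column_remove_row_col set_le_refl)
  moreover have "is_diagram n ?C"
    using C(1) by (auto simp: is_diagram_def remove_row_col_def)
  moreover have "C = augment k (w k) (rothe n w) ?C"
    using k(2) unfolding agrees_at_def augment_def remove_row_col_def by auto
  moreover have "\<forall>(i, j)\<in>?C. i \<noteq> k \<and> j \<noteq> w k"
    by (auto simp: remove_row_col_def)
  ultimately show "is_augmented n w C"
    using k(1) unfolding is_augmented_def by blast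
qed

section \<open>Counting diagrams column by column\<close>

lemma card_diagrams:
  assumes "\<And>j. Q j \<subseteq> Pow {1..n}"
  shows "card {C. is_diagram n C \<and> (\<forall>j\<in>{1..n}. column C j \<in> Q j)} =
    (\<Prod>j\<in>{1..n}. card (Q j))"
proof -
  let ?X = "{C. is_diagram n C \<and> (\<forall>j\<in>{1..n}. column C j \<in> Q j)}"
  have "bij_betw (\<lambda>C. restrict (column C) {1..n}) ?X (Pi\<^sub>E {1..n} Q)"
  \<comment> \<open>The inverse assembles a diagram from its family of columns.\<close>
  proof (rule bij_betw_byWitness[where f' = "\<lambda>g. {(i, j). j \<in> {1..n} \<and> i \<in> g j}"])
    show "\<forall>C\<in>?X. {(i, j). j \<in> {1..n} \<and> i \<in> restrict (column C) {1..n} j} = C"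
      by (auto simp: is_diagram_def column_def)
    show "\<forall>g\<in>Pi\<^sub>E {1..n} Q. restrict (column {(i, j). j \<in> {1..n} \<and> i \<in> g j}) {1..n} = g"
      by (fastforce simp: column_def PiE_def extensional_def fun_eq_iff)
    show "(\<lambda>C. restrict (column C) {1..n}) ` ?X \<subseteq> Pi\<^sub>E {1..n} Q"
      by auto
    show "(\<lambda>g. {(i, j). j \<in> {1..n} \<and> i \<in> g j}) ` Pi\<^sub>E {1..n} Q \<subseteq> ?X"
    proof
      fix C assume "C \<in> (\<lambda>g. {(i, j). j \<in> {1..n} \<and> i \<in> g j}) ` Pi\<^sub>E {1..n} Q"
      then obtain g where g: "g \<in> Pi\<^sub>E {1..n} Q" "C = {(i, j). j \<in> {1..n} \<and> i \<in> g j}"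
        by blast
      have "column C j = g j" "g j \<in> Q j" "g j \<subseteq> {1..n}" if "j \<in> {1..n}" for j
        using that g PiE_mem[OF g(1) that] assms[of j] by (auto simp: column_def)
      moreover from this(3) have "is_diagram n C"
        using g(2) by (fastforce simp: is_diagram_def)
      ultimately show "C \<in> ?X"
        by simp
    qed
  qed
  then show ?thesis
    by (simp add: bij_betw_same_card card_PiE)
qed

text \<open>Deleting the fixed part \<open>S \<inter> K\<close> is a bijection, with inverse adding
  it back.\<close>

lemma card_below_agreeing:
  assumes S: "S \<subseteq> {1..n}" and K: "K \<subseteq> {1..n}"
  shows "card {R \<in> below n S. R \<inter> K = S \<inter> K} =
    card {R. R \<subseteq> {1..n} - K \<and> set_le R (S \<inter> ({1..n} - K))}"
proof (rule bij_betw_same_card)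
  have le: "set_le (R - K) (S - K) \<longleftrightarrow> set_le R S" if "R \<subseteq> {1..n}" "R \<inter> K = S \<inter> K" for R
    using that S by (intro set_le_cong_common) (auto intro: finite_subset)
  have SK: "S \<inter> ({1..n} - K) = S - K"
    using S by blast
  let ?A = "{R \<in> below n S. R \<inter> K = S \<inter> K}"
  let ?B = "{R. R \<subseteq> {1..n} - K \<and> set_le R (S \<inter> ({1..n} - K))}"
  show "bij_betw (\<lambda>R. R - K) ?A ?B"
  proof (rule bij_betw_byWitness[where f' = "\<lambda>R. R \<union> (S \<inter> K)"])
    show "(\<lambda>R. R - K) ` ?A \<subseteq> ?B"
      unfolding SK using le by (auto simp: below_def)
    show "(\<lambda>R. R \<union> (S \<inter> K)) ` ?B \<subseteq> ?A"
    proof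
      fix R assume "R \<in> (\<lambda>R. R \<union> (S \<inter> K)) ` ?B"
      then obtain R' where R': "R' \<subseteq> {1..n} - K" "set_le R' (S - K)" "R = R' \<union> (S \<inter> K)"
 unfolding SK by blast
      then have "R - K = R'" "R \<inter> K = S \<inter> K" "R \<subseteq> {1..n}"
        using S by auto
      then show "R \<in> ?A"
        using R'(2) le[of R] by (simp add: below_def)
    qed
  qed auto
qed

lemma card_agreeing_diagrams:
  assumes w: "w permutes {1..n}" and K: "K \<subseteq> {1..n}"
  shows "card {C. is_diagram n C \<and> diagram_le n C (rothe n w) \<and> (\<forall>k\<in>K. agrees_at n w k C)} =
    (\<Prod>p\<in>{1..n} - K. card {R. R \<subseteq> {1..n} - K \<and> set_le R (rothe_column w p \<inter> ({1..n} - K))})"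
proof -
  let ?S = "column (rothe n w)"
  define Q where
    "Q j = {R \<in> below n (?S j). R \<inter> K = ?S j \<inter> K \<and> (j \<in> w ` K \<longrightarrow> R = ?S j)}" for j
  have wn: "w k \<in> {1..n}" if "k \<in> {1..n}" for k
    using w that by (simp only: permutes_in_image)
  have "is_diagram n C \<and> diagram_le n C (rothe n w) \<and> (\<forall>k\<in>K. agrees_at n w k C) \<longleftrightarrow>
      is_diagram n C \<and> (\<forall>j\<in>{1..n}. column C j \<in> Q j)" for C
  proof (cases "is_diagram n C")
    case True
    then have "column C j \<subseteq> {1..n}" for j
      by (auto simp: is_diagram_def column_def)
    moreover have "(\<forall>k\<in>K. agrees_at n w k C) \<longleftrightarrow> (\<forall>j\<in>{1..n}. column C j \<inter> K = ?S j \<inter> K \<and>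
        (j \<in> w ` K \<longrightarrow> column C j = ?S j))" (is "?L \<longleftrightarrow> ?R")
    proof
      assume ?L
      then show ?R
        by (fastforce simp: agrees_at_def column_def)
    next
      assume R: ?R
      show ?L
      proof
        fix k assume k: "k \<in> K"
        have "(k, j) \<in> C \<longleftrightarrow> (k, j) \<in> rothe n w" for j
        proof (cases "j \<in> {1..n}")
          case True
          then have "column C j \<inter> K = ?S j \<inter> K"
            using R by blast
          with k show ?thesis
            by (auto simp: column_def)
        next
          case False
          with True show ?thesis
            using is_diagram_rothe[of n w] by (auto simp: is_diagram_def)
        qed
        moreover have "column C (w k) = ?S (w k)"
          using R k K wn by blast
        ultimately show "agrees_at n w k C"
          by (auto simp: agrees_at_def column_def)
      qed
    qed
    ultimately show ?thesis
      using True by (auto simp: Q_def below_def diagram_le_def)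
  qed simp
  then have "card {C. is_diagram n C \<and> diagram_le n C (rothe n w) \<and> (\<forall>k\<in>K. agrees_at n w k C)}
      = (\<Prod>j\<in>{1..n}. card (Q j))"
    using card_diagrams[of Q n] by (simp add: Q_def below_def subset_iff)
  also have "\<dots> = (\<Prod>p\<in>{1..n}. card (Q (w p)))"
    using permutes_imp_bij[OF w] by (rule prod.reindex_bij_betw[symmetric])
  \<comment> \<open>The prescribed columns admit one choice each and contribute factors 1.\<close>
  also have "\<dots> = (\<Prod>p\<in>{1..n} - K. card (Q (w p)))"
  proof (rule prod.mono_neutral_right)
    show "\<forall>p\<in>{1..n} - ({1..n} - K). card (Q (w p)) = 1"
    proof
      fix p assume "p \<in> {1..n} - ({1..n} - K)"
      then have "Q (w p) = {?S (w p)}"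
        using is_diagram_rothe[of n w]
        by (auto simp: Q_def below_def set_le_refl is_diagram_def column_def)
      then show "card (Q (w p)) = 1"
        by simp
    qed
  qed auto
  also have "\<dots> = (\<Prod>p\<in>{1..n} - K.
      card {R. R \<subseteq> {1..n} - K \<and> set_le R (rothe_column w p \<inter> ({1..n} - K))})"
  proof (rule prod.cong)
    fix p assume p: "p \<in> {1..n} - K"
    then have "w p \<notin> w ` K"
      using permutes_inj[OF w] by (auto simp: inj_eq)
    then have "Q (w p) = {R \<in> below n (rothe_column w p). R \<inter> K = rothe_column w p \<inter> K}"
      using p by (simp add: Q_def column_rothe[OF w])
    moreover have "rothe_column w p \<subseteq> {1..n}"
      using p by (auto simp: rothe_column_def)
    ultimately show "card (Q (w p)) =
        card {R. R \<subseteq> {1..n} - K \<and> set_le R (rothe_column w p \<inter> ({1..n} - K))}"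
      using K by (simp only: card_below_agreeing)
  qed simp
  finally show ?thesis .
qed

section \<open>Inclusion-exclusion and the final count\<close>

text \<open>The indicator of satisfying no \<open>P k\<close> is a product of factors 1 minus an
  indicator; it is expanded over subsets of \<open>A\<close>.\<close>

lemma inclusion_exclusion_none:
  fixes P :: "'k \<Rightarrow> 'a \<Rightarrow> bool"
  assumes "finite X" "finite A"
  shows "(\<Sum>K\<in>Pow A. (- 1) ^ card K * int (card {C \<in> X. \<forall>k\<in>K. P k C})) =
    int (card {C \<in> X. \<forall>k\<in>A. \<not> P k C})"
proof -
  have count: "int (card {C \<in> X. Q C}) = (\<Sum>C\<in>X. of_bool (Q C))" for Q
    using assms(1) by (simp add: Int_def)
  have all: "of_bool (\<forall>k\<in>K. Q k) = (\<Prod>k\<in>K. of_bool (Q k) :: int)" if "K \<subseteq> A" for K Q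
    using finite_subset[OF that assms(2)] by (induction K rule: finite_induct) auto
  have "int (card {C \<in> X. \<forall>k\<in>A. \<not> P k C}) = (\<Sum>C\<in>X. \<Prod>k\<in>A. 1 - of_bool (P k C))"
    unfolding count by (intro sum.cong) (simp_all add: all of_bool_not_iff)
  also have "\<dots> = (\<Sum>C\<in>X. \<Sum>K\<in>Pow A. (- 1) ^ card K * of_bool (\<forall>k\<in>K. P k C))"
    using assms(2) by (intro sum.cong) (simp_all add: prod_diff_conv_sum all)
  also have "\<dots> = (\<Sum>K\<in>Pow A. (- 1) ^ card K * int (card {C \<in> X. \<forall>k\<in>K. P k C}))"
    unfolding count sum_distrib_left by (rule sum.swap)
  finally show ?thesis ..
qed

theorem theorem1p5:
  fixes n :: nat and w :: "nat \<Rightarrow> nat"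
  assumes "w permutes {1..n}"
    and "avoids_pattern (one_line n w) [1, 4, 3, 2]"
    and "avoids_pattern (one_line n w) [1, 4, 2, 3]"
  shows "c_coeff n w =
    int (card {C. is_diagram n C \<and> diagram_le n C (rothe n w) \<and> \<not> is_augmented n w C})"
proof -
  let ?X = "{C. is_diagram n C \<and> diagram_le n C (rothe n w)}"
  let ?v = "\<lambda>K. map w (sorted_list_of_set ({1..n} - K))"
  have avoid: "avoids_1432_1423 n w"
    using assms by (rule avoids_1432_1423I)
  have "c_coeff n w = (\<Sum>K\<in>Pow {1..n}. (- 1) ^ (n - length (?v K)) *
      eval_poly (schubert (length (?v K)) (perm (?v K))) (\<lambda>_. 1))"
    unfolding c_coeff_def using permutes_inj[OF assms(1)] by (rule sum_subwords)
  also have "\<dots> = (\<Sum>K\<in>Pow {1..n}. (- 1) ^ card K *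
      int (card {C \<in> ?X. \<forall>k\<in>K. agrees_at n w k C}))"
  proof (rule sum.cong)
    fix K assume "K \<in> Pow {1..n}"
    then have K: "K \<subseteq> {1..n}" by simp
    then have "n - length (?v K) = card K"
      using card_mono[OF _ K] by (simp add: card_Diff_subset finite_subset)
    \<comment> \<open>Both sides are the same product over the remaining positions.\<close>
    moreover have "eval_poly (schubert (length (?v K)) (perm (?v K))) (\<lambda>_. 1) =
        int (card {C \<in> ?X. \<forall>k\<in>K. agrees_at n w k C})"
      using schubert_perm_subword_at_1[OF assms(1) avoid, of "{1..n} - K"]
        card_agreeing_diagrams[OF assms(1) K] by (simp add: conj_assoc)
    ultimately show "(- 1) ^ (n - length (?v K)) *
        eval_poly (schubert (length (?v K)) (perm (?v K))) (\<lambda>_. 1) =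
        (- 1) ^ card K * int (card {C \<in> ?X. \<forall>k\<in>K. agrees_at n w k C})"
      by simp
  qed simp
  also have "\<dots> = int (card {C \<in> ?X. \<forall>k\<in>{1..n}. \<not> agrees_at n w k C})"
    by (intro inclusion_exclusion_none finite_subset[of ?X "Pow ({1..n} \<times> {1..n})"])
      (auto simp: is_diagram_def)
  also have "{C \<in> ?X. \<forall>k\<in>{1..n}. \<not> agrees_at n w k C} =
      {C. is_diagram n C \<and> diagram_le n C (rothe n w) \<and> \<not> is_augmented n w C}"
    using is_augmented_iff by blast
  finally show ?thesis .
qed

end
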